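(* Let $n\ge1$. For $Z:\mathrm{Conv}_{\mathrm{cd}}(\mathbb{R}^n)\to\mathbb{R}$ consider $Y:\mathcal{K}^{n+1}\to\mathbb{R}$ defined by $Y(K)=Z(\lfloor K\rfloor)$. Then $Y$ has the following properties: 1. If $Z$ is a valuation, then so is $Y$. 2. If $Z$ is continuous, then $Y$ is continuous with respect to the Hausdorff metric. 3. If $Z$ is epi-translation invariant, then $Y$ is translation invariant, that is, $Y(K+X)=Y(K)$ for all $K\in\mathcal{K}^{n+1}$, $X\in\mathbb{R}^{n+1}$. 4. If $Z$ is epi-homogeneous of degree $j$, then $Y$ is $j$-homogeneous, that is, $Y(tK)=t^jY(K)$ for all $K\in\mathcal{K}^{n+1}$, $t>0$.
   Context: $\mathrm{Conv}(\mathbb{R}^n)$ is the set of all convex, lower semi-continuous, proper (not identically $+\infty$) functions $u:\mathbb{R}^n\to(-\infty,+\infty]$, and $\mathrm{dom}(u)=\{x\in\mathbb{R}^n:u(x)<+\infty\}$. $\mathrm{Conv}_{\mathrm{sc}}(\mathbb{R}^n)=\{u\in\mathrm{Conv}(\mathbb{R}^n):\lim_{|x|\to\infty}u(x)/|x|=+\infty\}$, and $\mathrm{Conv}_{\mathrm{cd}}(\mathbb{R}^n)$ is the set of all $u\in\mathrm{Conv}_{\mathrm{sc}}(\mathbb{R}^n)$ such that $\mathrm{dom}(u)$ is compact. These spaces carry the (metrizable) topology of epi-convergence: $u_j$ epi-converges to $u$ if for every $x\in\mathbb{R}^n$ (i) $u(x)\le\liminf_j u_j(x_j)$ for every sequence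 $x_j\to x$, and (ii) there is a sequence $x_j\to x$ with $u(x)=\lim_j u_j(x_j)$. A functional $Z:\mathrm{Conv}_{\mathrm{cd}}(\mathbb{R}^n)\to\mathbb{R}$ is a valuation if $Z(u\wedge v)+Z(u\vee v)=Z(u)+Z(v)$ whenever $u,v$, their pointwise minimum $u\wedge v$ and their pointwise maximum $u\vee v$ all belong to $\mathrm{Conv}_{\mathrm{cd}}(\mathbb{R}^n)$. It is epi-translation invariant if $Z(u(\cdot-x)+c)=Z(u)$ for all $u$, all $x\in\mathbb{R}^n$ and $c\in\mathbb{R}$. It is epi-homogeneous of degree $j$ if $Z(t\cdot u(\cdot/t))=t^jZ(u)$ for all $u$ and all $t>0$, where $t\cdot u(\cdot/t)$ denotes the function $x\mapsto t\,u(x/t)$. $\mathcal{K}^{n+1}$ is the set of non-empty compact convex subsets of $\mathbb{R}^{n+1}=\mathbb{R}^n\times\mathbb{R}$. For $K\in\mathcal{K}^{n+1}$, $\lfloor K\rfloor:\mathbb{R}^n\to(-\infty,+\infty]$ is the function $\lfloor K\rfloor(x)=\inf\{t\in\mathbb{R}:(x,t)\in K\}$ (with $\inf\emptyset=+\infty$); it belongs to $\mathrm{Conv}_{\mathrm{cd}}(\mathbb{R}^n)$. A functional $Y:\mathcal{K}^{n+1}\to\mathbb{R}$ is a valuation if $Y(K\cup L)+Y(K\cap L)=Y(K)+Y(L)$ for all $K,L\in\mathcal{K}^{n+1}$ such that $K\cup L,K\cap L\in\mathcal{K}^{n+1}$. *)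

theory Defs
  imports "HOL-Analysis.Analysis"
begin

section \<open>Spaces of convex functions\<close>

definition dom_fun :: "(real ^ 'n \<Rightarrow> ereal) \<Rightarrow> (real ^ 'n) set" where
  "dom_fun u = {x. u x < \<infinity>}"

text \<open>The value \<open>-\<infinity>\<close> is excluded, so the right-hand side of the convexity inequality
  never involves \<open>\<infinity> - \<infinity>\<close>.\<close>

definition Conv :: "(real ^ 'n \<Rightarrow> ereal) set" where
  "Conv = {u.
     (\<forall>x. u x \<noteq> -\<infinity>) \<and> (\<exists>x. u x \<noteq> \<infinity>) \<and>
     (\<forall>x y. \<forall>t\<in>{0<..<1}. u ((1 - t) *\<^sub>R x + t *\<^sub>R y) \<le> ereal (1 - t) * u x + ereal t * u y) \<and>
     (\<forall>x. u x \<le> Liminf (at x) u)}"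

definition Conv_sc :: "(real ^ 'n \<Rightarrow> ereal) set" where
  "Conv_sc = {u \<in> Conv. ((\<lambda>x. u x / ereal (norm x)) \<longlongrightarrow> \<infinity>) at_infinity}"

definition Conv_cd :: "(real ^ 'n \<Rightarrow> ereal) set" where
  "Conv_cd = {u \<in> Conv_sc. compact (dom_fun u)}"


section \<open>Epi-convergence\<close>

definition epi_converges :: "(nat \<Rightarrow> real ^ 'n \<Rightarrow> ereal) \<Rightarrow> (real ^ 'n \<Rightarrow> ereal) \<Rightarrow> bool" where
  "epi_converges us u \<longleftrightarrow> (\<forall>x.
     (\<forall>xs. xs \<longlonglongrightarrow> x \<longrightarrow> u x \<le> liminf (\<lambda>j. us j (xs j))) \<and>
     (\<exists>xs. xs \<longlonglongrightarrow> x \<and> (\<lambda>j. us j (xs j)) \<longlonglongrightarrow> u x))"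

text \<open>A metrizable topology is determined by its convergent sequences: its open sets are
  exactly the sequentially open ones.  Hence the topology of epi-convergence on
  \<open>Conv_cd\<close> is the following one.\<close>

definition epi_open :: "(real ^ 'n \<Rightarrow> ereal) set \<Rightarrow> bool" where
  "epi_open U \<longleftrightarrow> U \<subseteq> Conv_cd \<and>
     (\<forall>us u. (\<forall>j. us j \<in> Conv_cd) \<and> u \<in> U \<and> epi_converges us u \<longrightarrow> (\<forall>\<^sub>F j in sequentially. us j \<in> U))"

definition epi_topology :: "(real ^ 'n \<Rightarrow> ereal) topology" where
  "epi_topology = topology epi_open"

lemma istopology_epi_open: "istopology epi_open"
  unfolding istopology_def
proof (intro conjI allI impI)
  fix S T :: "(real ^ 'n \<Rightarrow> ereal) set"
  assume *: "epi_open S" "epi_open T"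
  show "epi_open (S \<inter> T)"
    unfolding epi_open_def Int_iff
  proof (intro conjI allI impI)
    show "S \<inter> T \<subseteq> Conv_cd"
      using * unfolding epi_open_def by blast
    fix us u
    assume "(\<forall>j. us j \<in> Conv_cd) \<and> (u \<in> S \<and> u \<in> T) \<and> epi_converges us u"
    then have "\<forall>\<^sub>F j in sequentially. us j \<in> S" "\<forall>\<^sub>F j in sequentially. us j \<in> T"
      using * unfolding epi_open_def by metis+
    then show "\<forall>\<^sub>F j in sequentially. us j \<in> S \<and> us j \<in> T"
      by (rule eventually_conj)
  qed
next
  fix \<U> :: "(real ^ 'n \<Rightarrow> ereal) set set"
  assume *: "\<forall>S\<in>\<U>. epi_open S"
  show "epi_open (\<Union>\<U>)"
    unfolding epi_open_def
  proof (intro conjI allI impI)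
    show "\<Union>\<U> \<subseteq> Conv_cd"
      using * unfolding epi_open_def by blast
    fix us :: "nat \<Rightarrow> real ^ 'n \<Rightarrow> ereal" and u
    assume A: "(\<forall>j. us j \<in> Conv_cd) \<and> u \<in> \<Union>\<U> \<and> epi_converges us u"
    then obtain S where S: "S \<in> \<U>" "u \<in> S" by blast
    then have "\<forall>\<^sub>F j in sequentially. us j \<in> S"
      using * A unfolding epi_open_def by blast
    then show "\<forall>\<^sub>F j in sequentially. us j \<in> \<Union>\<U>"
      by (rule eventually_mono) (use S in blast)
  qed
qed

lemma openin_epi_topology [simp]: "openin epi_topology U \<longleftrightarrow> epi_open U"
  unfolding epi_topology_def by (simp add: topology_inverse'[OF istopology_epi_open])

lemma topspace_epi_topology [simp]: "topspace epi_topology = Conv_cd"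
proof -
  have "epi_open (Conv_cd :: (real ^ 'n \<Rightarrow> ereal) set)"
    unfolding epi_open_def by auto
  then show ?thesis
    unfolding topspace_def openin_epi_topology by (auto simp: epi_open_def)
qed

lemma continuous_map_epi_topology_iff:
  fixes Z :: "(real ^ 'n \<Rightarrow> ereal) \<Rightarrow> real"
  shows "continuous_map epi_topology euclideanreal Z \<longleftrightarrow>
    (\<forall>us u. (\<forall>j. us j \<in> Conv_cd) \<and> u \<in> Conv_cd \<and> epi_converges us u \<longrightarrow> (\<lambda>j. Z (us j)) \<longlonglongrightarrow> Z u)"
    (is "?L \<longleftrightarrow> ?R")
proof
  assume L: ?L
  show ?R
  proof (intro allI impI topological_tendstoI)
    fix us u and S :: "real set"
    assume A: "(\<forall>j. us j \<in> Conv_cd) \<and> u \<in> Conv_cd \<and> epi_converges us u" and S: "open S" "Z u \<in> S"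
    have "epi_open {v \<in> Conv_cd. Z v \<in> S}"
      using openin_continuous_map_preimage[OF L, of S] S by simp
    then have "\<forall>\<^sub>F j in sequentially. us j \<in> {v \<in> Conv_cd. Z v \<in> S}"
      using A S unfolding epi_open_def by blast
    then show "\<forall>\<^sub>F j in sequentially. Z (us j) \<in> S"
      by (rule eventually_mono) auto
  qed
next
  assume R: ?R
  have "epi_open {v \<in> Conv_cd. Z v \<in> S}" if "open S" for S
    unfolding epi_open_def
  proof (intro conjI allI impI)
    fix us u
    assume A: "(\<forall>j. us j \<in> Conv_cd) \<and> u \<in> {v \<in> Conv_cd. Z v \<in> S} \<and> epi_converges us u"
    then have "(\<lambda>j. Z (us j)) \<longlonglongrightarrow> Z u"
      using R by blast
    then have "\<forall>\<^sub>F j in sequentially. Z (us j) \<in> S"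
      using A that by (auto dest: topological_tendstoD)
    then show "\<forall>\<^sub>F j in sequentially. us j \<in> {v \<in> Conv_cd. Z v \<in> S}"
      by (rule eventually_mono) (use A in blast)
  qed auto
  then show ?L
    by (simp add: continuous_map)
qed


section \<open>Functionals on convex functions\<close>

text \<open>Functionals are total functions of which only the values on \<open>Conv_cd\<close> matter.\<close>

definition valuation_on_Conv_cd :: "((real ^ 'n \<Rightarrow> ereal) \<Rightarrow> real) \<Rightarrow> bool" where
  "valuation_on_Conv_cd Z \<longleftrightarrow> (\<forall>u\<in>Conv_cd. \<forall>v\<in>Conv_cd.
     (\<lambda>x. min (u x) (v x)) \<in> Conv_cd \<and> (\<lambda>x. max (u x) (v x)) \<in> Conv_cd \<longrightarrow>
     Z (\<lambda>x. min (u x) (v x)) + Z (\<lambda>x. max (u x) (v x)) = Z u + Z v)"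

definition epi_translation_invariant :: "((real ^ 'n \<Rightarrow> ereal) \<Rightarrow> real) \<Rightarrow> bool" where
  "epi_translation_invariant Z \<longleftrightarrow>
     (\<forall>u\<in>Conv_cd. \<forall>x. \<forall>c::real. Z (\<lambda>y. u (y - x) + ereal c) = Z u)"

definition epi_homogeneous :: "real \<Rightarrow> ((real ^ 'n \<Rightarrow> ereal) \<Rightarrow> real) \<Rightarrow> bool" where
  "epi_homogeneous j Z \<longleftrightarrow>
     (\<forall>u\<in>Conv_cd. \<forall>t>0. Z (\<lambda>x. ereal t * u (x /\<^sub>R t)) = t powr j * Z u)"


section \<open>Convex bodies\<close>

text \<open>The space \<open>\<real>\<^sup>n \<times> \<real>\<close> is rendered by the product type, whose norm is the Euclidean one.\<close>

definition convex_bodies :: "('a::euclidean_space) set set" where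
  "convex_bodies = {K. K \<noteq> {} \<and> compact K \<and> convex K}"

text \<open>For empty or unbounded arguments (never convex bodies) the value is set to 0, as a
  metric in the sense of the library has to be nonnegative off its carrier as well.\<close>

definition hausdorff_dist :: "('a::metric_space) set \<Rightarrow> 'a set \<Rightarrow> real" where
  "hausdorff_dist K L =
     (if K = {} \<or> L = {} \<or> \<not> bounded K \<or> \<not> bounded L then 0
      else max (SUP x\<in>K. infdist x L) (SUP y\<in>L. infdist y K))"

lemma bdd_above_infdist:
  assumes "bounded K"
  shows "bdd_above ((\<lambda>x. infdist x L) ` K)"
proof -
  obtain e x where e: "\<And>y. y \<in> K \<Longrightarrow> dist x y \<le> e"
    using assms unfolding bounded_def by blast
  have "infdist y L \<le> infdist x L + e" if "y \<in> K" for y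
    using infdist_triangle[of y L x] e[OF that] by (simp add: dist_commute)
  then show ?thesis
    by (rule bdd_aboveI2)
qed

lemma hausdorff_dist_le_iff:
  assumes "bounded K" "bounded L" "K \<noteq> {}" "L \<noteq> {}"
  shows "hausdorff_dist K L \<le> r \<longleftrightarrow> (\<forall>x\<in>K. infdist x L \<le> r) \<and> (\<forall>y\<in>L. infdist y K \<le> r)"
  using assms by (simp add: hausdorff_dist_def cSUP_le_iff bdd_above_infdist)

lemma infdist_le_hausdorff_dist:
  assumes "bounded K" "bounded L" "x \<in> K" "L \<noteq> {}"
  shows "infdist x L \<le> hausdorff_dist K L"
  using hausdorff_dist_le_iff[of K L "hausdorff_dist K L"] assms by auto

lemma hausdorff_dist_nonneg: "0 \<le> hausdorff_dist K L"
proof (cases "K = {} \<or> L = {} \<or> \<not> bounded K \<or> \<not> bounded L")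
  case False
  then obtain x where "x \<in> K" by blast
  then show ?thesis
    using infdist_le_hausdorff_dist[of K L x] infdist_nonneg[of x L] False by linarith
qed (simp add: hausdorff_dist_def)

lemma hausdorff_dist_commute: "hausdorff_dist K L = hausdorff_dist L K"
  by (auto simp: hausdorff_dist_def max.commute)

lemma Metric_space_hausdorff:
  "Metric_space (convex_bodies :: ('a::euclidean_space) set set) hausdorff_dist"
proof
  fix K L :: "'a set"
  assume "K \<in> convex_bodies" "L \<in> convex_bodies"
  then have KL: "bounded K" "bounded L" "closed K" "closed L" "K \<noteq> {}" "L \<noteq> {}"
    by (auto simp: convex_bodies_def compact_imp_bounded compact_imp_closed)
  have "hausdorff_dist K L = 0 \<longleftrightarrow> hausdorff_dist K L \<le> 0"
    using hausdorff_dist_nonneg[of K L] by linarith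
  also have "\<dots> \<longleftrightarrow> (\<forall>x\<in>K. infdist x L = 0) \<and> (\<forall>y\<in>L. infdist y K = 0)"
    using infdist_nonneg by (auto simp: hausdorff_dist_le_iff KL intro: antisym)
  also have "\<dots> \<longleftrightarrow> K = L"
    unfolding in_closed_iff_infdist_zero[OF \<open>closed K\<close> \<open>K \<noteq> {}\<close>, symmetric]
      in_closed_iff_infdist_zero[OF \<open>closed L\<close> \<open>L \<noteq> {}\<close>, symmetric] by blast
  finally show "hausdorff_dist K L = 0 \<longleftrightarrow> K = L" .
next
  fix K L M :: "'a set"
  assume "K \<in> convex_bodies" "L \<in> convex_bodies" "M \<in> convex_bodies"
  then have KLM: "bounded K" "bounded L" "bounded M" "K \<noteq> {}" "L \<noteq> {}" "M \<noteq> {}"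
      and cl: "closed L"
    by (auto simp: convex_bodies_def compact_imp_bounded compact_imp_closed)
  have *: "infdist x B \<le> hausdorff_dist A L + hausdorff_dist L B"
    if "bounded A" "bounded B" "A \<noteq> {}" "B \<noteq> {}" "x \<in> A" for x A B
  proof -
    obtain y where y: "y \<in> L" "infdist x L = dist x y"
      using infdist_attains_inf[of L x] KLM cl by blast
    have "infdist y B \<le> hausdorff_dist L B"
      using infdist_le_hausdorff_dist[of L B y] KLM that y by auto
    moreover have "infdist x L \<le> hausdorff_dist A L"
      using infdist_le_hausdorff_dist[of A L x] KLM that by auto
    ultimately show ?thesis
      using infdist_triangle[of x B y] y by linarith
  qed
  have "infdist x K \<le> hausdorff_dist K L + hausdorff_dist L M" if "x \<in> M" for x
    using *[of M K x] KLM that by (simp add: hausdorff_dist_commute)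
  then show "hausdorff_dist K M \<le> hausdorff_dist K L + hausdorff_dist L M"
    using *[of K M] KLM by (auto simp: hausdorff_dist_le_iff)
qed (auto simp: hausdorff_dist_nonneg hausdorff_dist_commute)

definition hausdorff_topology :: "('a::euclidean_space) set topology" where
  "hausdorff_topology = Metric_space.mtopology convex_bodies hausdorff_dist"

definition lower_boundary_fun :: "((real ^ 'n) \<times> real) set \<Rightarrow> real ^ 'n \<Rightarrow> ereal" where
  "lower_boundary_fun K x = (INF t\<in>{t. (x, t) \<in> K}. ereal t)"


section \<open>Functionals on convex bodies\<close>

definition valuation_on_bodies :: "(('a::euclidean_space) set \<Rightarrow> real) \<Rightarrow> bool" where
  "valuation_on_bodies Y \<longleftrightarrow> (\<forall>K\<in>convex_bodies. \<forall>L\<in>convex_bodies.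
     K \<union> L \<in> convex_bodies \<and> K \<inter> L \<in> convex_bodies \<longrightarrow>
     Y (K \<union> L) + Y (K \<inter> L) = Y K + Y L)"

definition translation_invariant :: "(('a::euclidean_space) set \<Rightarrow> real) \<Rightarrow> bool" where
  "translation_invariant Y \<longleftrightarrow> (\<forall>K\<in>convex_bodies. \<forall>X. Y ((\<lambda>p. p + X) ` K) = Y K)"

definition homogeneous :: "real \<Rightarrow> (('a::euclidean_space) set \<Rightarrow> real) \<Rightarrow> bool" where
  "homogeneous j Y \<longleftrightarrow> (\<forall>K\<in>convex_bodies. \<forall>t>0. Y ((\<lambda>p. t *\<^sub>R p) ` K) = t powr j * Y K)"

end

theory Submission
  imports Defs
begin

text \<open>Everything rests on the fact that, for compact \<open>K\<close>, the infimum defining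
  \<open>\<lfloor>K\<rfloor>(x)\<close> is attained, so that \<open>\<lfloor>K\<rfloor>(x) \<le> r\<close> means that \<open>K\<close> contains a point \<open>(x, t)\<close>
  with \<open>t \<le> r\<close>. Since an extended real number is determined by its real upper bounds, this turns
  translations and dilations of bodies into epi-translations and epi-multiplications; for intersections, a vertical segment in \<open>K \<union> L\<close> joining \<open>K\<close> to \<open>L\<close> is
  connected and hence meets \<open>K \<inter> L\<close>. Hausdorff convergence implies epi-convergence because a
  point \<open>(x, r)\<close> with \<open>r < \<lfloor>K\<rfloor>(x)\<close> lies, together with the whole ray below it, at positive
  distance from \<open>K\<close>, while nearest points in \<open>K\<^sub>j\<close> provide recovery sequences.\<close>

section \<open>Real upper bounds and attained infima\<close>

lemma ereal_eqI_real_upper_bounds: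
  fixes a b :: ereal
  assumes "\<And>r. a \<le> ereal r \<longleftrightarrow> b \<le> ereal r"
  shows "a = b"
  by (rule antisym; rule ereal_le_real) (use assms in auto)

lemma lower_boundary_fun_le_iff:
  assumes "compact K"
  shows "lower_boundary_fun K x \<le> ereal r \<longleftrightarrow> (\<exists>t\<le>r. (x, t) \<in> K)"
proof
  assume le: "lower_boundary_fun K x \<le> ereal r"
  let ?F = "K \<inter> ({x} \<times> UNIV)"
  have "?F \<noteq> {}"
  proof
    assume "?F = {}"
    then have "{t. (x, t) \<in> K} = {}" by auto
    \<comment> \<open>Over an empty fibre the infimum is \<infinity>, which no real \<open>r\<close>
      bounds from above.\<close>
    with le show False by (simp add: lower_boundary_fun_def top_ereal_def)
  qed
  moreover have "compact ?F"
    by (intro compact_Int_closed assms closed_Times) auto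
  ultimately obtain p where p: "p \<in> ?F" "\<And>q. q \<in> ?F \<Longrightarrow> snd p \<le> snd q"
    using continuous_attains_inf[of ?F snd] continuous_on_snd[OF continuous_on_id] by blast
  have "ereal (snd p) \<le> lower_boundary_fun K x"
    unfolding lower_boundary_fun_def using p(2) by (intro INF_greatest) force
  with le have "snd p \<le> r" by (metis ereal_less_eq(3) order.trans)
  with p(1) show "\<exists>t\<le>r. (x, t) \<in> K" by (cases p) auto
next
  assume "\<exists>t\<le>r. (x, t) \<in> K"
  then show "lower_boundary_fun K x \<le> ereal r"
    unfolding lower_boundary_fun_def
    by (metis INF_lower2 ereal_less_eq(3) mem_Collect_eq)
qed

section \<open>Lower boundary functions belong to \<open>Conv_cd\<close>\<close>

text \<open>Compactness bounds the heights \<open>snd p\<close> of all points of \<open>K\<close>,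
  and an empty fibre gives \<infinity>. The uniform real bound serves to exclude the value
  -\<infinity>.\<close>

lemma lower_boundary_fun_ge_real:
  assumes "compact K"
  obtains c where "\<And>x. ereal c \<le> lower_boundary_fun K x"
proof -
  have "bounded (snd ` K)"
    using assms by (intro compact_imp_bounded compact_continuous_image continuous_intros)
  then obtain b where "\<And>p. p \<in> K \<Longrightarrow> \<bar>snd p\<bar> \<le> b"
    unfolding bounded_iff by auto
  then have "ereal (-b) \<le> lower_boundary_fun K x" for x
    unfolding lower_boundary_fun_def by (intro INF_greatest) force
  then show ?thesis by (rule that)
qed

lemma lower_boundary_fun_neq_MInf:
  assumes "compact K"
  shows "lower_boundary_fun K x \<noteq> -\<infinity>"
  using lower_boundary_fun_ge_real[OF assms] by (metis MInfty_neq_ereal(1) ereal_infty_less_eq(2))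

lemma dom_fun_lower_boundary_fun:
  assumes "compact K"
  shows "dom_fun (lower_boundary_fun K) = fst ` K"
proof -
  have "lower_boundary_fun K x < \<infinity> \<longleftrightarrow> (\<exists>r. lower_boundary_fun K x \<le> ereal r)" for x
    by (cases "lower_boundary_fun K x") auto
  then show ?thesis
    by (force simp: dom_fun_def lower_boundary_fun_le_iff[OF assms])
qed

text \<open>For finite values, choose points of \<open>K\<close> over \<open>x\<close> and
  \<open>y\<close> at or below the graph; their convex combination lies in \<open>K\<close> and
  bounds the left side.\<close>

lemma lower_boundary_fun_convex:
  assumes K: "compact K" "convex K" and t: "t \<in> {0<..<1}"
  shows "lower_boundary_fun K ((1 - t) *\<^sub>R x + t *\<^sub>R y)
    \<le> ereal (1 - t) * lower_boundary_fun K x + ereal t * lower_boundary_fun K y"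
proof (cases "lower_boundary_fun K x = \<infinity> \<or> lower_boundary_fun K y = \<infinity>")
  \<comment> \<open>Both weights are positive and -\<infinity> is excluded, so the right side is
    \<infinity>.\<close>
  case True
  then show ?thesis
    using t lower_boundary_fun_neq_MInf[OF K(1)]
    by (cases "lower_boundary_fun K x"; cases "lower_boundary_fun K y") auto
next
  case False
  then obtain a b where ab: "lower_boundary_fun K x = ereal a" "lower_boundary_fun K y = ereal b"
    using lower_boundary_fun_neq_MInf[OF K(1)] by (meson ereal_cases)
  then obtain a' b' where le: "a' \<le> a" "b' \<le> b" and mem: "(x, a') \<in> K" "(y, b') \<in> K"
    using lower_boundary_fun_le_iff[OF K(1)] by (metis order_refl)
  have "(1 - t) *\<^sub>R (x, a') + t *\<^sub>R (y, b') \<in> K"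
    using K(2) mem t by (intro convexD) auto
  moreover have "(1 - t) * a' + t * b' \<le> (1 - t) * a + t * b"
    using le t by (intro add_mono mult_left_mono) auto
  ultimately show ?thesis
    using ab by (auto simp: lower_boundary_fun_le_iff[OF K(1)])
qed

text \<open>Real sublevel sets are projections of the compact sets
  \<open>K \<inter> (UNIV \<times> {..r})\<close>, hence closed.\<close>

lemma lower_boundary_fun_lsc:
  assumes "compact K"
  shows "lower_boundary_fun K x \<le> Liminf (at x) (lower_boundary_fun K)"
  unfolding le_Liminf_iff
proof (intro allI impI)
  fix y assume "y < lower_boundary_fun K x"
  then obtain r where r: "y < ereal r" "ereal r < lower_boundary_fun K x"
    using ereal_dense2 by blast
  have "compact (fst ` (K \<inter> (UNIV \<times> {..r})))"
    by (intro compact_continuous_image continuous_intros compact_Int_closed assms closed_Times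
        closed_UNIV closed_atMost)
  moreover have "fst ` (K \<inter> (UNIV \<times> {..r})) = {z. lower_boundary_fun K z \<le> ereal r}"
    by (force simp: lower_boundary_fun_le_iff[OF assms])
  ultimately have "open (- {z. lower_boundary_fun K z \<le> ereal r})"
    by (metis compact_imp_closed open_Compl)
  then have "\<forall>\<^sub>F z in at x. z \<in> - {z. lower_boundary_fun K z \<le> ereal r}"
    by (rule eventually_at_in_open') (use r(2) in simp)
  then show "\<forall>\<^sub>F z in at x. y < lower_boundary_fun K z"
    by (rule eventually_mono) (use r(1) in auto)
qed

text \<open>Superlinear growth comes for free: the domain is bounded, so the quotient is eventually
  constantly \<infinity>.\<close>

lemma lower_boundary_fun_in_Conv_cd:
  assumes "K \<in> convex_bodies"
  shows "lower_boundary_fun K \<in> Conv_cd"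
proof -
  have K: "K \<noteq> {}" "compact K" "convex K"
    using assms by (auto simp: convex_bodies_def)
  have cpt: "compact (dom_fun (lower_boundary_fun K))"
    unfolding dom_fun_lower_boundary_fun[OF K(2)]
    by (intro compact_continuous_image continuous_intros K)
  have "dom_fun (lower_boundary_fun K) \<noteq> {}"
    using K by (simp add: dom_fun_lower_boundary_fun)
  then have "\<exists>x. lower_boundary_fun K x \<noteq> \<infinity>"
    by (auto simp: dom_fun_def)
  then have "lower_boundary_fun K \<in> Conv"
    using lower_boundary_fun_neq_MInf[OF K(2)] lower_boundary_fun_convex[OF K(2,3)]
      lower_boundary_fun_lsc[OF K(2)]
    by (simp add: Conv_def)
  moreover obtain b where b: "\<And>x. x \<in> dom_fun (lower_boundary_fun K) \<Longrightarrow> norm x \<le> b"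
    using compact_imp_bounded[OF cpt] unfolding bounded_iff by blast
  have "\<forall>\<^sub>F x in at_infinity. lower_boundary_fun K x / ereal (norm x) = \<infinity>"
    unfolding eventually_at_infinity
  proof (intro exI allI impI)
    fix x :: "real ^ 'a"
    \<comment> \<open>This radius makes \<open>norm x\<close> positive and strictly larger than the
      bound \<open>b\<close> of the domain.\<close>
    assume x: "max 0 b + 1 \<le> norm x"
    then have "x \<notin> dom_fun (lower_boundary_fun K)"
      using b[of x] by auto
    then have "lower_boundary_fun K x = \<infinity>"
      by (simp add: dom_fun_def)
    with x show "lower_boundary_fun K x / ereal (norm x) = \<infinity>"
      by (auto simp: divide_ereal_def)
  qed
  then have "((\<lambda>x. lower_boundary_fun K x / ereal (norm x)) \<longlongrightarrow> \<infinity>) at_infinity"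
    by (rule tendsto_eventually)
  ultimately show ?thesis
    using cpt by (simp add: Conv_cd_def Conv_sc_def)
qed

section \<open>Unions, intersections, translations and dilations\<close>

lemma lower_boundary_fun_Un:
  "lower_boundary_fun (K \<union> L) = (\<lambda>x. min (lower_boundary_fun K x) (lower_boundary_fun L x))"
proof
  fix x
  have "{t. (x, t) \<in> K \<union> L} = {t. (x, t) \<in> K} \<union> {t. (x, t) \<in> L}"
    by auto
  then show "lower_boundary_fun (K \<union> L) x = min (lower_boundary_fun K x) (lower_boundary_fun L x)"
    by (simp only: lower_boundary_fun_def INF_union inf_min)
qed

lemma lower_boundary_fun_Int:
  assumes K: "compact K" and L: "compact L" and conv: "convex (K \<union> L)"
  shows "lower_boundary_fun (K \<inter> L) = (\<lambda>x. max (lower_boundary_fun K x) (lower_boundary_fun L x))"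
proof (intro ext ereal_eqI_real_upper_bounds)
  fix x r
  have "\<exists>t\<le>r. (x, t) \<in> K \<inter> L" if st: "s \<le> r" "(x, s) \<in> K" "t \<le> r" "(x, t) \<in> L" for s t
  proof -
    let ?S = "closed_segment (x, s) (x, t)"
    have sub: "?S \<subseteq> K \<union> L"
      using conv st by (intro closed_segment_subset) auto
    have "K \<inter> L \<inter> ?S \<noteq> {}"
    proof
      assume "K \<inter> L \<inter> ?S = {}"
      \<comment> \<open>Otherwise the closed sets \<open>K\<close> and \<open>L\<close> would
        separate the segment. One of them must then miss it, although each contains an
        endpoint.\<close>
      with connected_closedD[OF connected_segment(1) this sub] K L
      have "K \<inter> ?S = {} \<or> L \<inter> ?S = {}"
        by (auto dest: compact_imp_closed)
      with st show False by auto
    qed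
    then obtain p where p: "p \<in> K \<inter> L" "p \<in> ?S" by blast
    \<comment> \<open>This keeps the common point over \<open>x\<close> and at height at most
      \<open>r\<close>.\<close>
    have "?S \<subseteq> {x} \<times> {..r}"
      by (intro closed_segment_subset convex_Times convex_singleton) (use st in auto)
    with p show ?thesis by auto
  qed
  then show "lower_boundary_fun (K \<inter> L) x \<le> ereal r \<longleftrightarrow>
      max (lower_boundary_fun K x) (lower_boundary_fun L x) \<le> ereal r"
    by (auto simp: lower_boundary_fun_le_iff K L compact_Int)
qed

lemma lower_boundary_fun_translate:
  assumes "compact K"
  shows "lower_boundary_fun ((\<lambda>p. p + X) ` K)
    = (\<lambda>y. lower_boundary_fun K (y - fst X) + ereal (snd X))"
proof (intro ext ereal_eqI_real_upper_bounds)
  fix x r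
  have cpt: "compact ((\<lambda>p. p + X) ` K)"
    by (intro compact_continuous_image continuous_intros assms)
  have "(x, t) \<in> (\<lambda>p. p + X) ` K \<longleftrightarrow> (x - fst X, t - snd X) \<in> K" for t
    by (cases X) (force simp: image_iff)
  then have "lower_boundary_fun ((\<lambda>p. p + X) ` K) x \<le> ereal r
      \<longleftrightarrow> (\<exists>t\<le>r. (x - fst X, t - snd X) \<in> K)"
    by (simp add: lower_boundary_fun_le_iff[OF cpt])
  also have "\<dots> \<longleftrightarrow> (\<exists>t\<le>r - snd X. (x - fst X, t) \<in> K)"
    by (metis add_diff_cancel diff_right_mono le_diff_eq)
  also have "\<dots> \<longleftrightarrow> lower_boundary_fun K (x - fst X) \<le> ereal (r - snd X)"
    by (simp add: lower_boundary_fun_le_iff[OF assms])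
  also have "\<dots> \<longleftrightarrow> lower_boundary_fun K (x - fst X) + ereal (snd X) \<le> ereal r"
    by (cases "lower_boundary_fun K (x - fst X)") auto
  finally show "lower_boundary_fun ((\<lambda>p. p + X) ` K) x \<le> ereal r
      \<longleftrightarrow> lower_boundary_fun K (x - fst X) + ereal (snd X) \<le> ereal r" .
qed

lemma lower_boundary_fun_scale:
  assumes "compact K" and t: "t > 0"
  shows "lower_boundary_fun ((\<lambda>p. t *\<^sub>R p) ` K)
    = (\<lambda>x. ereal t * lower_boundary_fun K (x /\<^sub>R t))"
proof (intro ext ereal_eqI_real_upper_bounds)
  fix x r
  have cpt: "compact ((\<lambda>p. t *\<^sub>R p) ` K)"
    by (intro compact_continuous_image continuous_intros assms)
  have "(x, s) \<in> (\<lambda>p. t *\<^sub>R p) ` K \<longleftrightarrow> (x /\<^sub>R t, s / t) \<in> K" for s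
    using t by (force simp: image_iff)
  then have "lower_boundary_fun ((\<lambda>p. t *\<^sub>R p) ` K) x \<le> ereal r
      \<longleftrightarrow> (\<exists>s\<le>r. (x /\<^sub>R t, s / t) \<in> K)"
    by (simp add: lower_boundary_fun_le_iff[OF cpt])
  \<comment> \<open>Heights are reparametrised by \<open>s / t\<close>, which preserves order
    because \<open>t > 0\<close>.\<close>
  also have "\<dots> \<longleftrightarrow> (\<exists>s\<le>r / t. (x /\<^sub>R t, s) \<in> K)"
    using t by (metis divide_right_mono less_imp_le nonzero_mult_div_cancel_right
        order_less_irrefl pos_le_divide_eq)
  also have "\<dots> \<longleftrightarrow> lower_boundary_fun K (x /\<^sub>R t) \<le> ereal (r / t)"
    by (simp add: lower_boundary_fun_le_iff[OF assms(1)])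
  also have "\<dots> \<longleftrightarrow> ereal t * lower_boundary_fun K (x /\<^sub>R t) \<le> ereal r"
    using t by (cases "lower_boundary_fun K (x /\<^sub>R t)") (auto simp: field_simps)
  finally show "lower_boundary_fun ((\<lambda>p. t *\<^sub>R p) ` K) x \<le> ereal r
      \<longleftrightarrow> ereal t * lower_boundary_fun K (x /\<^sub>R t) \<le> ereal r" .
qed

section \<open>From Hausdorff convergence to epi-convergence\<close>

text \<open>Closedness of \<open>L\<close> makes the infimal distance attained. Applied from
  \<open>Ks j\<close> to \<open>K\<close> this gives the liminf inequality, and from
  \<open>K\<close> to \<open>Ks j\<close> the recovery sequence.\<close>

lemma nearest_point_hausdorff_dist:
  assumes "K \<in> convex_bodies" "L \<in> convex_bodies" "p \<in> K"
  obtains q where "q \<in> L" "dist p q \<le> hausdorff_dist K L"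
proof -
  have "closed L" "L \<noteq> {}" "bounded K" "bounded L"
    using assms by (auto simp: convex_bodies_def compact_imp_closed compact_imp_bounded)
  then show ?thesis
    using that infdist_attains_inf[of L p] infdist_le_hausdorff_dist[of K L p] assms(3) by metis
qed

lemma hausdorff_convergence_liminf:
  assumes Ks: "\<And>j. Ks j \<in> convex_bodies" and K: "K \<in> convex_bodies"
    and lim: "(\<lambda>j. hausdorff_dist (Ks j) K) \<longlonglongrightarrow> 0" and xs: "xs \<longlonglongrightarrow> x"
  shows "lower_boundary_fun K x \<le> liminf (\<lambda>j. lower_boundary_fun (Ks j) (xs j))"
  unfolding le_Liminf_iff
proof (intro allI impI)
  fix y assume "y < lower_boundary_fun K x"
  then obtain r where r: "y < ereal r" "ereal r < lower_boundary_fun K x"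
    using ereal_dense2 by blast
  have cpt: "compact K" "\<And>j. compact (Ks j)"
    using K Ks by (auto simp: convex_bodies_def)
  have "K \<inter> ({x} \<times> {..r}) = {}"
    using r(2) lower_boundary_fun_le_iff[OF cpt(1), of x r] by auto
  moreover have "closed ({x} \<times> {..r})"
    by (intro closed_Times) auto
  ultimately obtain d where d: "d > 0" "\<And>p q. p \<in> K \<Longrightarrow> q \<in> {x} \<times> {..r} \<Longrightarrow> d \<le> dist p q"
    using separate_compact_closed[OF cpt(1), of "{x} \<times> {..r}"] by metis
  \<comment> \<open>The gap \<open>d\<close> is split: one half for passing from \<open>Ks j\<close>
    to \<open>K\<close>, the other for the horizontal shift from \<open>xs j\<close> to
    \<open>x\<close>.\<close>
  have "\<forall>\<^sub>F j in sequentially. hausdorff_dist (Ks j) K < d / 2"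
    by (rule order_tendstoD(2)[OF lim]) (use d(1) in simp)
  moreover have "\<forall>\<^sub>F j in sequentially. dist (xs j) x < d / 2"
    by (rule tendstoD[OF xs]) (use d(1) in simp)
  ultimately show "\<forall>\<^sub>F j in sequentially. y < lower_boundary_fun (Ks j) (xs j)"
  proof eventually_elim
    case (elim j)
    have "\<not> lower_boundary_fun (Ks j) (xs j) \<le> ereal r"
    proof
      assume "lower_boundary_fun (Ks j) (xs j) \<le> ereal r"
      then obtain t where t: "t \<le> r" "(xs j, t) \<in> Ks j"
        by (auto simp: lower_boundary_fun_le_iff[OF cpt(2)])
      then obtain q where q: "q \<in> K" "dist (xs j, t) q \<le> hausdorff_dist (Ks j) K"
        using nearest_point_hausdorff_dist[OF Ks K] by metis
      \<comment> \<open>The height \<open>t\<close> is retained, so \<open>(x, t)\<close> still lies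
        on the ray below \<open>r\<close>, too close to the point \<open>q\<close> of
        \<open>K\<close>.\<close>
      have "dist q (x, t) \<le> dist (xs j, t) q + dist (xs j, t) (x, t)"
        by (rule dist_triangle3)
      also have "dist (xs j, t) (x, t) = dist (xs j) x"
        by (simp add: dist_Pair_Pair)
      finally have "dist q (x, t) < d"
        using elim q by linarith
      with d(2)[OF q(1), of "(x, t)"] t show False by simp
    qed
    with r(1) show ?case by simp
  qed
qed

lemma hausdorff_convergence_imp_epi_convergence:
  assumes Ks: "\<And>j. Ks j \<in> convex_bodies" and K: "K \<in> convex_bodies"
    and lim: "(\<lambda>j. hausdorff_dist (Ks j) K) \<longlonglongrightarrow> 0"
  shows "epi_converges (\<lambda>j. lower_boundary_fun (Ks j)) (lower_boundary_fun K)"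
  unfolding epi_converges_def
proof (intro allI conjI impI)
  fix x
  have cpt: "compact K" "\<And>j. compact (Ks j)"
    using K Ks by (auto simp: convex_bodies_def)
  note liminf = hausdorff_convergence_liminf[OF Ks K lim]
  show "lower_boundary_fun K x \<le> liminf (\<lambda>j. lower_boundary_fun (Ks j) (xs j))"
    if "xs \<longlonglongrightarrow> x" for xs
    by (rule liminf[OF that])
  show "\<exists>xs. xs \<longlonglongrightarrow> x \<and> (\<lambda>j. lower_boundary_fun (Ks j) (xs j)) \<longlonglongrightarrow> lower_boundary_fun K x"
  proof (cases "lower_boundary_fun K x")
    \<comment> \<open>Outside the domain the constant sequence works: the liminf inequality already
      forces the limit \<infinity>.\<close>
    case PInf
    have "(\<lambda>j. lower_boundary_fun (Ks j) x) \<longlonglongrightarrow> \<infinity>"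
      using liminf[OF tendsto_const, of x] unfolding PInf le_Liminf_iff
      by (intro order_tendstoI) simp_all
    with PInf show ?thesis
      by (intro exI[of _ "\<lambda>_. x"]) simp
  next
    case MInf
    with lower_boundary_fun_neq_MInf[OF cpt(1)] show ?thesis by blast
  next
    case (real a)
    then obtain t where t: "t \<le> a" "(x, t) \<in> K"
      using lower_boundary_fun_le_iff[OF cpt(1), of x a] by auto
    \<comment> \<open>Points of \<open>Ks j\<close> close to \<open>(x, t)\<close>; their base
      points \<open>fst (q j)\<close> form the recovery sequence.\<close>
    have "\<exists>q. q \<in> Ks j \<and> dist (x, t) q \<le> hausdorff_dist (Ks j) K" for j
      using nearest_point_hausdorff_dist[OF K Ks t(2), of j] hausdorff_dist_commute by metis
    then obtain q where q: "\<And>j. q j \<in> Ks j" "\<And>j. dist (x, t) (q j) \<le> hausdorff_dist (Ks j) K"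
      by metis
    have "q \<longlonglongrightarrow> (x, t)"
      using q(2) by (intro metric_tendsto_imp_tendsto[OF lim])
        (simp add: dist_commute hausdorff_dist_nonneg)
    from tendsto_fst[OF this] tendsto_snd[OF this]
    have fst: "(\<lambda>j. fst (q j)) \<longlonglongrightarrow> x" and snd: "(\<lambda>j. snd (q j)) \<longlonglongrightarrow> t"
      by simp_all
    have "(\<lambda>j. lower_boundary_fun (Ks j) (fst (q j))) \<longlonglongrightarrow> lower_boundary_fun K x"
    proof (rule order_tendstoI)
      show "\<forall>\<^sub>F j in sequentially. y < lower_boundary_fun (Ks j) (fst (q j))"
        if "y < lower_boundary_fun K x" for y
        using liminf[OF fst] that by (auto simp: le_Liminf_iff)
    next
      \<comment> \<open>The upper half: the values at \<open>fst (q j)\<close> are at most the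
        heights \<open>snd (q j)\<close>, which tend to \<open>t \<le> a\<close>.\<close>
      fix y assume "lower_boundary_fun K x < y"
      with t(1) real have "ereal t < y"
        by (metis ereal_less_eq(3) order.strict_trans1)
      moreover have "(\<lambda>j. ereal (snd (q j))) \<longlonglongrightarrow> ereal t"
        using snd by simp
      ultimately have "\<forall>\<^sub>F j in sequentially. ereal (snd (q j)) < y"
        by (rule order_tendstoD(2)[rotated])
      then show "\<forall>\<^sub>F j in sequentially. lower_boundary_fun (Ks j) (fst (q j)) < y"
      proof eventually_elim
        case (elim j)
        have "lower_boundary_fun (Ks j) (fst (q j)) \<le> ereal (snd (q j))"
          unfolding lower_boundary_fun_le_iff[OF cpt(2)] using q(1)[of j] by auto
        with elim show ?case by simp
      qed
    qed
    with fst show ?thesis by blast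
  qed
qed

section \<open>Transfer of the four properties from \<open>Z\<close> to \<open>Y\<close>\<close>

text \<open>In a metric topology closed sets are the sequentially closed ones, so preimages of
  closed sets can be tested along sequences.\<close>

lemma continuous_map_hausdorff_topologyI:
  fixes Y :: "('a::euclidean_space) set \<Rightarrow> real"
  assumes "\<And>Ks K. (\<And>j. Ks j \<in> convex_bodies) \<Longrightarrow> K \<in> convex_bodies \<Longrightarrow>
    (\<lambda>j. hausdorff_dist (Ks j) K) \<longlonglongrightarrow> 0 \<Longrightarrow> (\<lambda>j. Y (Ks j)) \<longlonglongrightarrow> Y K"
  shows "continuous_map hausdorff_topology euclideanreal Y"
proof -
  interpret H: Metric_space "convex_bodies :: 'a set set" hausdorff_dist
    by (rule Metric_space_hausdorff)
  have "closedin H.mtopology {K \<in> convex_bodies. Y K \<in> C}" if C: "closed C" for C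
    unfolding H.metric_closedin_iff_sequentially_closed
  proof (intro conjI allI impI)
    fix Ks K
    assume A: "range Ks \<subseteq> {K \<in> convex_bodies. Y K \<in> C} \<and> limitin H.mtopology Ks K sequentially"
    then have mem: "Ks j \<in> convex_bodies" "Y (Ks j) \<in> C" for j
      by auto
    have K: "K \<in> convex_bodies" "(\<lambda>j. hausdorff_dist (Ks j) K) \<longlonglongrightarrow> 0"
      using A by (auto simp: H.limitin_metric_dist_null)
    have "Y K \<in> C"
      using closed_sequentially[OF C mem(2) assms[OF mem(1) K]] .
    with K show "K \<in> {K \<in> convex_bodies. Y K \<in> C}" by simp
  qed auto
  then show ?thesis
    by (simp add: hausdorff_topology_def continuous_map_closedin)
qed

theorem theorem3p10:
  fixes Z :: "(real ^ 'n \<Rightarrow> ereal) \<Rightarrow> real"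
    and Y :: "((real ^ 'n) \<times> real) set \<Rightarrow> real"
  assumes "\<And>K. K \<in> convex_bodies \<Longrightarrow> Y K = Z (lower_boundary_fun K)"
  shows "(valuation_on_Conv_cd Z \<longrightarrow> valuation_on_bodies Y) \<and>
    (continuous_map epi_topology euclideanreal Z \<longrightarrow>
       continuous_map hausdorff_topology euclideanreal Y) \<and>
    (epi_translation_invariant Z \<longrightarrow> translation_invariant Y) \<and>
    (\<forall>j. epi_homogeneous j Z \<longrightarrow> homogeneous j Y)"
proof (intro conjI impI allI)
  assume Z: "valuation_on_Conv_cd Z"
  show "valuation_on_bodies Y"
    unfolding valuation_on_bodies_def
  proof (intro ballI impI, elim conjE)
    fix K L :: "((real ^ 'n) \<times> real) set"
    assume mem: "K \<in> convex_bodies" "L \<in> convex_bodies"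
      "K \<union> L \<in> convex_bodies" "K \<inter> L \<in> convex_bodies"
    \<comment> \<open>The assumption \<open>K \<union> L \<in> convex_bodies\<close> supplies the
      convexity behind the segment argument.\<close>
    then have "lower_boundary_fun (K \<inter> L)
        = (\<lambda>x. max (lower_boundary_fun K x) (lower_boundary_fun L x))"
      by (intro lower_boundary_fun_Int) (auto simp: convex_bodies_def)
    with Z mem show "Y (K \<union> L) + Y (K \<inter> L) = Y K + Y L"
      using mem[THEN lower_boundary_fun_in_Conv_cd]
      by (simp add: assms valuation_on_Conv_cd_def lower_boundary_fun_Un)
  qed
next
  assume Z: "continuous_map epi_topology euclideanreal Z"
  show "continuous_map hausdorff_topology euclideanreal Y"
  proof (rule continuous_map_hausdorff_topologyI)
    fix Ks and K :: "((real ^ 'n) \<times> real) set"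
    assume mem: "\<And>j. Ks j \<in> convex_bodies" "K \<in> convex_bodies"
      and lim: "(\<lambda>j. hausdorff_dist (Ks j) K) \<longlonglongrightarrow> 0"
    \<comment> \<open>Continuity for \<open>epi_topology\<close> amounts to sequential continuity
      along epi-convergent sequences in \<open>Conv_cd\<close>.\<close>
    show "(\<lambda>j. Y (Ks j)) \<longlonglongrightarrow> Y K"
      using Z hausdorff_convergence_imp_epi_convergence[OF mem lim]
        mem[THEN lower_boundary_fun_in_Conv_cd]
      by (simp add: continuous_map_epi_topology_iff assms mem)
  qed
next
  assume Z: "epi_translation_invariant Z"
  show "translation_invariant Y"
    unfolding translation_invariant_def
  proof (intro ballI allI)
    fix K :: "((real ^ 'n) \<times> real) set" and X :: "(real ^ 'n) \<times> real"
    assume K: "K \<in> convex_bodies"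
    \<comment> \<open>This is the form in which \<open>compact_translation\<close> and
      \<open>convex_translation\<close> apply.\<close>
    moreover have "(\<lambda>p. p + X) ` K = (+) X ` K"
      by (simp add: add.commute)
    ultimately have "(\<lambda>p. p + X) ` K \<in> convex_bodies"
      by (simp only: convex_bodies_def mem_Collect_eq image_is_empty compact_translation
          convex_translation simp_thms)
    with Z K lower_boundary_fun_in_Conv_cd[OF K] show "Y ((\<lambda>p. p + X) ` K) = Y K"
      by (simp add: assms epi_translation_invariant_def lower_boundary_fun_translate
          convex_bodies_def)
  qed
next
  fix j assume Z: "epi_homogeneous j Z"
  show "homogeneous j Y"
    unfolding homogeneous_def
  proof (intro ballI allI impI)
    fix K :: "((real ^ 'n) \<times> real) set" and t :: real
    assume K: "K \<in> convex_bodies" and t: "t > 0"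
    then have "(\<lambda>p. t *\<^sub>R p) ` K \<in> convex_bodies"
      by (auto simp: convex_bodies_def convex_scaling compact_scaling)
    with Z K t lower_boundary_fun_in_Conv_cd[OF K]
    show "Y ((\<lambda>p. t *\<^sub>R p) ` K) = t powr j * Y K"
      by (simp add: assms epi_homogeneous_def lower_boundary_fun_scale convex_bodies_def)
  qed
qed

end
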